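(* Let $\lambda$ be a nonzero real number. For all integers $n,p\ge 0$, $$\beta_{n,\lambda}^{(p)}=\frac{p+1}{n+p+1}\sum_{k=0}^{n}(-1)^{n-k}A_\lambda(n,k)\binom{p+n}{p+k}^{-1},$$ where $A_\lambda(n,k)$ denotes the degenerate type Eulerian numbers.
   Context: For real $\mu$ and $x$: $(x)_{0,\mu}=1$ and $(x)_{n,\mu}=x(x-\mu)(x-2\mu)\cdots(x-(n-1)\mu)$ for $n\ge 1$; thus $(1)_{k+1,1/\lambda}$ is this symbol with $x=1$, $\mu=1/\lambda$. Also $\langle a\rangle_0=1$, $\langle a\rangle_k=a(a+1)\cdots(a+k-1)$ for $k\ge1$. The degenerate exponential is the formal power series $e_\lambda(t)=\sum_{n\ge0}(1)_{n,\lambda}\frac{t^n}{n!}$. The Gauss hypergeometric series is ${}_2F_1(a,b;c;x)=\sum_{k\ge0}\frac{\langle a\rangle_k\langle b\rangle_k}{\langle c\rangle_k}\frac{x^k}{k!}$. For an integer $p\ge-1$, the generalized degenerate Bernoulli numbers $\beta_{n,\lambda}^{(p)}$ ($n\ge0$) are defined by the identity of formal power series in $t$ $${}_2F_1\big(1-\lambda,1;p+2;1-e_\lambda(t)\big)=\sum_{n=0}^\infty\beta_{n,\lambda}^{(p)}\frac{t^n}{n!}.$$ Let $\triangle f(x)=f(x+1)-f(x)$, so $\triangle^k f(x)=\sum_{j=0}^k\binom{k}{j}(-1)^{k-j}f(x+j)$, and let $\triangle^k(0)_{n,\lambda}$ denote the value at $x=0$ of $\triangle^k$ applied to $x\mapsto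 (x)_{n,\lambda}$. The degenerate type Eulerian numbers $A_\lambda(n,m)$ (written $\left\langle {n\atop m}\right\rangle_{\lambda}$ in the paper), for integers $0\le m\le n$, are defined by $$(-1)^{n-m}A_\lambda(n,m)=\sum_{k=0}^{n-m}\lambda^k(1)_{k+1,1/\lambda}\binom{n-k}{m}\frac{\triangle^k(0)_{n,\lambda}}{k!}.$$ *)

theory Defs
  imports Complex_Main "HOL-Computational_Algebra.Formal_Power_Series"
begin

text \<open>The degenerate falling factorial, \<open>x (x - \<mu>) \<dots> (x - (n - 1) \<mu>)\<close>.\<close>

definition degen_ffact :: "real \<Rightarrow> nat \<Rightarrow> real \<Rightarrow> real" where
  "degen_ffact x n \<mu> = (\<Prod>i<n. x - real i * \<mu>)"

definition degen_exp :: "real \<Rightarrow> real fps" where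
  "degen_exp lam = Abs_fps (\<lambda>n. degen_ffact 1 n lam / fact n)"

text \<open>
  The inner series \<open>1 - degen_exp lam\<close> has vanishing constant term, so the formal composition below
  is the genuine substitution. The series is an exponential generating function, whence the factor
  \<open>fact n\<close>. The definition is meant for \<open>p \<ge> -1\<close>; for smaller \<open>p\<close> the hypergeometric series
  would have vanishing denominators.
\<close>

definition degen_bernoulli :: "real \<Rightarrow> int \<Rightarrow> nat \<Rightarrow> real" where
  "degen_bernoulli lam p n =
     fact n * fps_nth (fps_hypergeo [1 - lam, 1] [of_int p + 2] 1 oo (1 - degen_exp lam)) n"

definition fwd_diff :: "(real \<Rightarrow> real) \<Rightarrow> real \<Rightarrow> real" where
  "fwd_diff f = (\<lambda>x. f (x + 1) - f x)"

text \<open>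
  The degenerate type Eulerian numbers, meant for \<open>m \<le> n\<close>. They are specified by a formula for
  \<open>(-1) ^ (n - m)\<close> times the number; as this sign is its own inverse, it is moved to the right-hand
  side.
\<close>

definition degen_eulerian :: "real \<Rightarrow> nat \<Rightarrow> nat \<Rightarrow> real" where
  "degen_eulerian lam n m =
     (-1) ^ (n - m) *
     (\<Sum>k=0..n-m. lam ^ k * degen_ffact 1 (k + 1) (1 / lam) * real ((n - k) choose m) *
        ((fwd_diff ^^ k) (\<lambda>x. degen_ffact x n lam) 0 / fact k))"

end

theory Submission
  imports Defs
begin

text \<open>
  The \<open>k\<close>-th power of \<open>degen_exp lam - 1\<close> is the exponential generating function of
  the differences \<open>\<triangle>\<^sup>k(0)\<^bsub>n,\<lambda>\<^esub>\<close>, so expanding the hypergeometric series gives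
  \<open>\<beta>\<^sub>n = (\<Sum>k\<le>n. c\<^sub>k \<triangle>\<^sup>k(0)\<^bsub>n,\<lambda>\<^esub> / \<langle>p + 2\<rangle>\<^sub>k)\<close> with
  \<open>c\<^sub>k = \<lambda>\<^sup>k (1)\<^bsub>k+1,1/\<lambda>\<^esub> = (-1)\<^sup>k \<langle>1 - \<lambda>\<rangle>\<^sub>k\<close>. Inserting the definition of the Eulerian numbers
  on the other side and exchanging the sums, it remains to evaluate a sum of ratios of binomial
  coefficients. Since \<open>1 / (N choose j)\<close> is \<open>N + 1\<close> times a Beta integral, this is
  \<open>\<integral> x\<^sup>p (1 - x)\<^sup>k (x + (1 - x))\<^sup>N dx = \<integral> x\<^sup>p (1 - x)\<^sup>k dx\<close> over the unit interval; the proof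
  iterates the underlying recurrence \<open>B(a, b) = B(a + 1, b) + B(a, b + 1)\<close>.
\<close>

lemma degen_ffact_gbinomial:
  assumes "lam \<noteq> 0"
  shows "degen_ffact x n lam / fact n = lam ^ n * ((x / lam) gchoose n)"
proof -
  have "degen_ffact x n lam = (\<Prod>i<n. lam * (x / lam - real i))"
    unfolding degen_ffact_def using assms by (intro prod.cong) (auto simp: field_simps)
  also have "\<dots> = lam ^ n * (\<Prod>i<n. x / lam - real i)"
    by (simp add: prod.distrib)
  finally show ?thesis
    by (simp add: gbinomial_prod_rev atLeast0LessThan)
qed

text \<open>Coefficientwise this is Vandermonde's convolution with upper arguments
  \<open>x / lam\<close> and \<open>1 / lam\<close>.\<close>

lemma degen_ffact_egf_add_one:
  assumes "lam \<noteq> 0"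
  shows "Abs_fps (\<lambda>n. degen_ffact (x + 1) n lam / fact n) =
    Abs_fps (\<lambda>n. degen_ffact x n lam / fact n) * degen_exp lam"
proof (rule fps_ext)
  fix n
  have "(\<Sum>i=0..n. degen_ffact x i lam / fact i * (degen_ffact 1 (n - i) lam / fact (n - i))) =
      lam ^ n * (\<Sum>i=0..n. ((x / lam) gchoose i) * ((1 / lam) gchoose (n - i)))"
    unfolding degen_ffact_gbinomial[OF assms] sum_distrib_left
    by (intro sum.cong) (auto simp flip: power_add)
  also have "\<dots> = degen_ffact (x + 1) n lam / fact n"
    by (simp add: degen_ffact_gbinomial[OF assms] gbinomial_Vandermonde add_divide_distrib)
  finally show "fps_nth (Abs_fps (\<lambda>n. degen_ffact (x + 1) n lam / fact n)) n =
      fps_nth (Abs_fps (\<lambda>n. degen_ffact x n lam / fact n) * degen_exp lam) n"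
    by (simp add: fps_mult_nth degen_exp_def)
qed

text \<open>Shifting \<open>x\<close> by one multiplies the generating function by
  \<open>degen_exp lam\<close>, so each difference contributes a factor
  \<open>degen_exp lam - 1\<close>.\<close>

lemma fwd_diff_degen_ffact:
  assumes "lam \<noteq> 0"
  shows "(fwd_diff ^^ k) (\<lambda>x. degen_ffact x n lam) x =
    fact n * fps_nth (Abs_fps (\<lambda>n. degen_ffact x n lam / fact n) * (degen_exp lam - 1) ^ k) n"
proof (induction k arbitrary: x)
  case 0
  show ?case by simp
next
  case (Suc k)
  show ?case
    by (simp add: fwd_diff_def[of "(fwd_diff ^^ k) f" for f] Suc degen_ffact_egf_add_one[OF assms] algebra_simps)
qed

lemma fwd_diff_degen_ffact_0:
  assumes "lam \<noteq> 0"
  shows "(fwd_diff ^^ k) (\<lambda>x. degen_ffact x n lam) 0 = fact n * fps_nth ((degen_exp lam - 1) ^ k) n"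
proof -
  have "Abs_fps (\<lambda>n. degen_ffact 0 n lam / fact n) = 1"
  proof (rule fps_ext)
    fix m
    show "fps_nth (Abs_fps (\<lambda>n. degen_ffact 0 n lam / fact n)) m = fps_nth 1 m"
      by (cases m) (simp_all add: degen_ffact_gbinomial[OF assms] gbinomial_0)
  qed
  then show ?thesis
    by (simp add: fwd_diff_degen_ffact[OF assms])
qed

lemma power_mult_degen_ffact_inverse:
  assumes "lam \<noteq> 0"
  shows "lam ^ k * degen_ffact 1 (k + 1) (1 / lam) = (-1) ^ k * pochhammer (1 - lam) k"
proof -
  have "lam ^ k * degen_ffact 1 (k + 1) (1 / lam) = (\<Prod>i<k. lam * (1 - real (Suc i) * (1 / lam)))"
    \<comment> \<open>The factor of index 0 equals 1; the other \<open>k\<close> factors absorb one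
      \<open>lam\<close> each.\<close>
    unfolding degen_ffact_def Suc_eq_plus1[symmetric] prod.lessThan_Suc_shift
    by (simp add: prod.distrib)
  also have "\<dots> = (\<Prod>i<k. - 1 * (1 - lam + real i))"
    using assms by (intro prod.cong) (auto simp: field_simps)
  also have "\<dots> = (-1) ^ k * pochhammer (1 - lam) k"
    by (subst prod.distrib) (simp add: pochhammer_prod atLeast0LessThan)
  finally show ?thesis .
qed

lemma degen_bernoulli_sum:
  assumes "lam \<noteq> 0"
  shows "degen_bernoulli lam (int p) n =
    (\<Sum>k=0..n. lam ^ k * degen_ffact 1 (k + 1) (1 / lam) *
       (fwd_diff ^^ k) (\<lambda>x. degen_ffact x n lam) 0 / pochhammer (real p + 2) k)"
proof -
  have "(1 - degen_exp lam) ^ k = fps_const ((-1) ^ k) * (degen_exp lam - 1) ^ k" for k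
  proof -
    have "(1 - degen_exp lam) ^ k = (fps_const (-1) * (degen_exp lam - 1)) ^ k"
      by (simp flip: fps_const_neg)
    then show ?thesis
      by (simp only: power_mult_distrib fps_const_power)
  qed
  then show ?thesis
    unfolding degen_bernoulli_def fps_compose_nth sum_distrib_left
      power_mult_degen_ffact_inverse[OF assms] fwd_diff_degen_ffact_0[OF assms]
    \<comment> \<open>The numerator parameter 1 gives \<open>pochhammer 1 k = fact k\<close>, which
      cancels the factorial of the hypergeometric series.\<close>
    by (intro sum.cong) (auto simp: pochhammer_fact[symmetric])
qed

text \<open>The model case is \<open>f a b = x ^ a * y ^ b\<close> with \<open>x + y = 1\<close>,
  where this is the binomial theorem. In general, Pascal's rule splits the sum into those starting
  at \<open>(Suc a, b)\<close> and \<open>(a, Suc b)\<close>.\<close>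

lemma sum_choose_recurrence:
  fixes f :: "nat \<Rightarrow> nat \<Rightarrow> 'a::comm_semiring_1"
  assumes "\<And>a b. f a b = f (Suc a) b + f a (Suc b)"
  shows "(\<Sum>m\<le>N. of_nat (N choose m) * f (a + m) (b + (N - m))) = f a b"
proof (induction N arbitrary: a b)
  case 0
  show ?case by simp
next
  case (Suc N)
  have "(\<Sum>m\<le>Suc N. of_nat (Suc N choose m) * f (a + m) (b + (Suc N - m))) =
      (\<Sum>m\<le>N. of_nat (N choose m) * f (Suc a + m) (b + (N - m))) +
      (f a (b + Suc N) + (\<Sum>m\<le>N. of_nat (N choose Suc m) * f (Suc a + m) (b + (N - m))))"
    by (subst sum.atMost_Suc_shift) (simp add: sum.distrib algebra_simps)
  also have "f a (b + Suc N) + (\<Sum>m\<le>N. of_nat (N choose Suc m) * f (Suc a + m) (b + (N - m))) =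
      (\<Sum>m\<le>Suc N. of_nat (N choose m) * f (a + m) (b + (Suc N - m)))"
    by (subst sum.atMost_Suc_shift) simp
  also have "\<dots> = (\<Sum>m\<le>N. of_nat (N choose m) * f (a + m) (Suc b + (N - m)))"
    by (simp add: Suc_diff_le binomial_eq_0)
  finally show ?case
    by (simp only: Suc assms[of a b])
qed

lemma sum_choose_divide_choose:
  "(\<Sum>m\<le>N. real (N choose m) / real ((a + b + N) choose (a + m))) =
    real (a + b + N + 1) * fact a * fact b / fact (a + b + 1)"
proof -
  \<comment> \<open>The Beta value \<open>B(a + 1, b + 1)\<close>, the integral of
    \<open>x ^ a * (1 - x) ^ b\<close> over the unit interval.\<close>
  define f :: "nat \<Rightarrow> nat \<Rightarrow> real" where "f = (\<lambda>a b. fact a * fact b / fact (a + b + 1))"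
  have "f a b = f (Suc a) b + f a (Suc b)" for a b
    by (simp add: f_def divide_simps) algebra
  then have *: "(\<Sum>m\<le>N. real (N choose m) * f (a + m) (b + (N - m))) = f a b"
    by (rule sum_choose_recurrence)
  have "1 / real ((a + b + N) choose (a + m)) = real (a + b + N + 1) * f (a + m) (b + (N - m))"
    if "m \<le> N" for m
  proof -
    have "a + b + N - (a + m) = b + (N - m)" "a + m + (b + (N - m)) = a + b + N"
      using that by auto
    then show ?thesis
      using that by (simp add: binomial_fact f_def divide_simps) (simp add: add_ac)
  qed
  then have "(\<Sum>m\<le>N. real (N choose m) * (1 / real ((a + b + N) choose (a + m)))) =
      (\<Sum>m\<le>N. real (N choose m) * (real (a + b + N + 1) * f (a + m) (b + (N - m))))"
    by (intro sum.cong) auto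
  also have "\<dots> = real (a + b + N + 1) * f a b"
    unfolding *[symmetric] sum_distrib_left by (intro sum.cong) auto
  finally show ?thesis
    by (simp add: f_def)
qed

lemma sum_choose_divide_choose_pochhammer:
  assumes "k \<le> n"
  shows "(real p + 1) / (real n + real p + 1) *
      (\<Sum>m=0..n-k. real ((n - k) choose m) / real ((p + n) choose (p + m))) / fact k =
    1 / pochhammer (real p + 2) k"
proof -
  \<comment> \<open>With \<open>a = p\<close>, \<open>b = k\<close>, \<open>N = n - k\<close> the
    upper index \<open>a + b + N\<close> is \<open>p + n\<close>, independent of
    \<open>k\<close>.\<close>
  have *: "(\<Sum>m=0..n-k. real ((n - k) choose m) / real ((p + n) choose (p + m))) =
      (real n + real p + 1) * fact p * fact k / fact (p + k + 1)"
    using sum_choose_divide_choose[of "n - k" p k] assms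
    by (simp add: atLeast0AtMost algebra_simps)
  have "(fact (p + k + 1) :: real) = fact (p + 1) * pochhammer (real p + 2) k"
    using pochhammer_product'[of "1 :: real" "p + 1" k]
    by (simp add: pochhammer_fact algebra_simps del: fact_Suc)
  then have "(fact (p + k + 1) :: real) = (real p + 1) * fact p * pochhammer (real p + 2) k"
    by (simp add: algebra_simps)
  moreover have "pochhammer (real p + 2) k > 0"
    by (intro pochhammer_pos) simp
  moreover have "real n + real p + 1 > 0" by simp
  ultimately show ?thesis
    unfolding * by (simp add: divide_simps del: fact_Suc)
qed

theorem theorem4:
  fixes lam :: real and n p :: nat
  assumes "lam \<noteq> 0"
  shows "degen_bernoulli lam (int p) n =
    (real p + 1) / (real n + real p + 1) *
    (\<Sum>k=0..n. (-1) ^ (n - k) * degen_eulerian lam n k * inverse (real ((p + n) choose (p + k))))"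
proof -
  define t where "t k = lam ^ k * degen_ffact 1 (k + 1) (1 / lam) *
    (fwd_diff ^^ k) (\<lambda>x. degen_ffact x n lam) 0" for k
  have "(\<Sum>m=0..n. (-1) ^ (n - m) * degen_eulerian lam n m * inverse (real ((p + n) choose (p + m)))) =
      (\<Sum>m=0..n. \<Sum>k=0..n-m. t k / fact k * (real ((n - k) choose m) / real ((p + n) choose (p + m))))"
    \<comment> \<open>The two signs \<open>(-1) ^ (n - m)\<close> cancel.\<close>
    unfolding degen_eulerian_def mult.assoc[symmetric] power_mult_distrib[symmetric]
    by (simp add: sum_distrib_right sum_distrib_left t_def field_simps)
  also have "\<dots> =
      (\<Sum>k=0..n. \<Sum>m=0..n-k. t k / fact k * (real ((n - k) choose m) / real ((p + n) choose (p + m))))"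
    \<comment> \<open>Both double sums run over the triangle \<open>k + m \<le> n\<close>.\<close>
    unfolding sum.Sigma[OF finite_atLeastAtMost ballI[OF finite_atLeastAtMost]]
    by (rule sum.reindex_bij_witness[of _ prod.swap prod.swap]) auto
  finally have eq: "(\<Sum>m=0..n. (-1) ^ (n - m) * degen_eulerian lam n m * inverse (real ((p + n) choose (p + m)))) =
      (\<Sum>k=0..n. \<Sum>m=0..n-k. t k / fact k * (real ((n - k) choose m) / real ((p + n) choose (p + m))))" .
  have "(real p + 1) / (real n + real p + 1) *
      (\<Sum>m=0..n. (-1) ^ (n - m) * degen_eulerian lam n m * inverse (real ((p + n) choose (p + m)))) =
      (\<Sum>k=0..n. t k * ((real p + 1) / (real n + real p + 1) *
        (\<Sum>m=0..n-k. real ((n - k) choose m) / real ((p + n) choose (p + m))) / fact k))"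
    unfolding eq sum_distrib_left sum_divide_distrib by (intro sum.cong refl) (simp add: mult_ac)
  also have "\<dots> = (\<Sum>k=0..n. t k / pochhammer (real p + 2) k)"
    by (intro sum.cong refl) (simp only: sum_choose_divide_choose_pochhammer atLeastAtMost_iff, simp)
  finally show ?thesis
    by (simp add: degen_bernoulli_sum[OF assms] t_def)
qed

end
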